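(* Let $n\ge 2$, let $0<\gamma_{2n-1}<\cdots<\gamma_1$ be real numbers and put $c_i=1/\gamma_i$. Let $\{1,\ldots,2n-1\}=J\cup K$ with $J=J_n$, $K=K_n$ the decomposition defined by $J_1=\{1\}$, $J_2=\{2,3\}$, $J_n=J_{n-2}\cup\{2n-2,2n-1\}$, $K_n=J_{n-1}$. Then the generalized Cayley condition $\mathcal{C}(n,n)$ is equivalent to each of the following four conditions: (i) If $P(x)=\prod_{j\in J}(x-\gamma_j)$, then $P(x)-P(0)=x\prod_{k\in K}(x-\gamma_k)$. (ii) $\prod_{j\in J}(\gamma_j-\gamma_k)=\prod_{j\in J}\gamma_j$ for all $k\in K$. (iii) $\mathrm{e}_l(\{\gamma_j\}_{j\in J})=\mathrm{e}_l(\{\gamma_k\}_{k\in K})$ for all $l=1,\ldots,n-1$. (iv) $\sum_{j\in J}\gamma_j^l=\sum_{k\in K}\gamma_k^l$ for all $l=1,\ldots,n-1$.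
   Context: $\mathrm{e}_l(\cdot)$ denotes the elementary symmetric polynomial of degree $l$ in the listed parameters. Generalized Cayley condition: for $m\ge n$, write $f(t)=\sqrt{\prod_{i=1}^{2n-1}(1-t/c_i)}=\sum_{l\ge0}f_lt^l$ with $f(0)=1$; $\mathcal{C}(m,n)$ is the condition $$\operatorname{rank}\begin{pmatrix} f_{m+1}&\cdots&f_{n+1}\\ \vdots&&\vdots\\ f_{2m-1}&\cdots&f_{m+n-1}\end{pmatrix}<m-n+1,$$ where the matrix is $(m-1)\times(m-n+1)$ with $(i,j)$ entry $f_{m+1+i-j}$. In particular, $\mathcal{C}(n,n)$ says $f_{n+1}=\cdots=f_{2n-1}=0$. (In the billiard setting, $\{c_1,\ldots,c_{2n-1}\}$ is the union of the parameters $a_1,\ldots,a_n$ of an ellipsoid $\sum x_j^2/a_j=1$ and the parameters $\lambda_1,\ldots,\lambda_{n-1}$ of the caustics, ordered as $0<c_1<\cdots<c_{2n-1}$.) *)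

theory Defs
  imports
    "HOL-Analysis.FPS_Convergence"
    "Jordan_Normal_Form.DL_Rank"
begin

text \<open>
  The series \<open>f(t) = \<Sum>\<^sub>l f\<^sub>l t\<^sup>l\<close> is the formal square root with constant coefficient \<open>root 2 1 = 1\<close>.
  The lemma \<open>cayley_series_expansion\<close> below shows that it is the power series expansion
  at \<open>0\<close> of the real function \<open>t \<mapsto> sqrt (\<Prod>i=1..2n-1. 1 - t / c\<^sub>i)\<close>.
\<close>

definition cayley_series :: "nat \<Rightarrow> (nat \<Rightarrow> real) \<Rightarrow> real fps" where
  "cayley_series n c = fps_radical root 2 (\<Prod>i=1..2*n-1. 1 - fps_const (1 / c i) * fps_X)"

text \<open>
  Rows and columns are numbered from \<open>0\<close>, which leaves \<open>i - j\<close> unchanged. For \<open>m \<ge> n\<close> the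
  subtractions below do not truncate, since \<open>j \<le> m - n\<close>.
\<close>

definition cayley_matrix :: "nat \<Rightarrow> nat \<Rightarrow> (nat \<Rightarrow> real) \<Rightarrow> real mat" where
  "cayley_matrix m n c =
     mat (m - 1) (m - n + 1) (\<lambda>(i, j). fps_nth (cayley_series n c) (m + 1 + i - j))"

definition cayley_condition :: "nat \<Rightarrow> nat \<Rightarrow> (nat \<Rightarrow> real) \<Rightarrow> bool" where
  "cayley_condition m n c \<longleftrightarrow> vec_space.rank (m - 1) (cayley_matrix m n c) < m - n + 1"

text \<open>The value at \<open>0\<close> is a convention, compatible with the recursion.\<close>

fun index_J :: "nat \<Rightarrow> nat set" where
  "index_J 0 = {}"
| "index_J (Suc 0) = {1}"
| "index_J (Suc (Suc 0)) = {2, 3}"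
| "index_J (Suc (Suc (Suc k))) =
     index_J (Suc k) \<union> {2 * Suc (Suc (Suc k)) - 2, 2 * Suc (Suc (Suc k)) - 1}"

definition index_K :: "nat \<Rightarrow> nat set" where
  "index_K n = index_J (n - 1)"

definition elem_sym :: "nat \<Rightarrow> (nat \<Rightarrow> real) \<Rightarrow> nat set \<Rightarrow> real" where
  "elem_sym l x A = (\<Sum>S | S \<subseteq> A \<and> card S = l. \<Prod>i\<in>S. x i)"


lemma index_J_rec: "n \<ge> 2 \<Longrightarrow> index_J n = index_J (n - 2) \<union> {2 * n - 2, 2 * n - 1}"
  by (cases n rule: index_J.cases) auto

lemma index_J_Suc:
  "index_J (Suc n) \<union> index_J n = {1..2 * n + 1} \<and> index_J (Suc n) \<inter> index_J n = {}"
proof (induction n)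
  case 0
  then show ?case by auto
next
  case (Suc n)
  have "index_J (Suc (Suc n)) = index_J n \<union> {2 * n + 2, 2 * n + 3}"
    using index_J_rec[of "Suc (Suc n)"] by (simp add: numeral_3_eq_3)
  moreover have "{1..2 * Suc n + 1} = {1..2 * n + 1} \<union> {2 * n + 2, 2 * n + 3}"
    by auto
  moreover have "index_J (Suc n) \<subseteq> {1..2 * n + 1}"
    using Suc by blast
  then have "2 * n + 2 \<notin> index_J (Suc n)" "2 * n + 3 \<notin> index_J (Suc n)"
    by auto
  ultimately show ?case
    using Suc by auto
qed

lemma index_JK_decomposition:
  assumes "n \<ge> 1"
  shows "index_J n \<union> index_K n = {1..2 * n - 1}" "index_J n \<inter> index_K n = {}"
  using index_J_Suc[of "n - 1"] assms by (auto simp: index_K_def)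

lemma fps_nth_prod_0: "fps_nth (\<Prod>i\<in>A. f i) 0 = (\<Prod>i\<in>A. fps_nth (f i) 0)"
  for f :: "'a \<Rightarrow> real fps"
  by (induction A rule: infinite_finite_induct) simp_all

lemma cayley_series_nth_0: "fps_nth (cayley_series n c) 0 = 1"
  by (simp add: cayley_series_def fps_nth_prod_0)

lemma cayley_series_square:
  "cayley_series n c ^ 2 = (\<Prod>i=1..2*n-1. 1 - fps_const (1 / c i) * fps_X)" (is "_ = ?A")
proof -
  have "fps_nth ?A 0 = 1"
    by (simp add: fps_nth_prod_0)
  then have "fps_radical root (Suc 1) ?A ^ Suc 1 = ?A"
    by (subst power_radical[symmetric]) auto
  then show ?thesis
    unfolding cayley_series_def by (simp add: numeral_2_eq_2)
qed

lemma cayley_series_expansion: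
  "(\<lambda>t. sqrt (\<Prod>i=1..2*n-1. 1 - t / c i)) has_fps_expansion cayley_series n c"
proof -
  define G where "G = (\<lambda>a::real. fps_binomial (1/2) oo (fps_const a * fps_X))"
  have G_nth: "fps_nth (G a) k = ((1/2) gchoose k) * a ^ k" for a k
    by (simp add: G_def fps_nth_compose_linear)
  have "fps_binomial (1/2 :: real) ^ 2 = 1 + fps_X"
    by (simp add: power2_eq_square fps_binomial_add_mult[symmetric] fps_binomial_1)
  then have G_square: "G a ^ 2 = 1 + fps_const a * fps_X" for a
    by (simp add: G_def fps_compose_power fps_compose_add_distrib)
  have G_expansion: "(\<lambda>t. sqrt (1 + a * t)) has_fps_expansion G a" for a
  proof (rule has_fps_expansionI)
    have "((\<lambda>t. \<bar>a * t\<bar>) \<longlongrightarrow> \<bar>a * 0\<bar>) (nhds (0::real))"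
      by (intro tendsto_intros filterlim_ident)
    then have "eventually (\<lambda>t. \<bar>a * t\<bar> < 1) (nhds 0)"
      by (rule order_tendstoD(2)) simp
    then show "eventually (\<lambda>t. (\<lambda>k. fps_nth (G a) k * t ^ k) sums sqrt (1 + a * t)) (nhds 0)"
    proof eventually_elim
      case (elim t)
      then show ?case
        using sqrt_series[of "a * t"] by (simp add: G_nth power_mult_distrib mult.assoc)
    qed
  qed
  define F where "F = (\<Prod>i=1..2*n-1. G (- 1 / c i))"
  have "sqrt (\<Prod>i\<in>A. 1 - t / c i) = (\<Prod>i\<in>A. sqrt (1 + (- 1 / c i) * t))" for t and A :: "nat set"
    by (induction A rule: infinite_finite_induct) (simp_all add: real_sqrt_mult)
  then have "(\<lambda>t. sqrt (\<Prod>i=1..2*n-1. 1 - t / c i)) has_fps_expansion F"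
    unfolding F_def by (simp only:) (intro has_fps_expansion_prod G_expansion)
  moreover have "F = cayley_series n c"
  proof -
    have "G (- 1 / c i) ^ 2 = 1 - fps_const (1 / c i) * fps_X" for i
      by (simp add: G_square flip: fps_const_neg)
    then have "F ^ 2 = cayley_series n c ^ 2"
      by (simp add: F_def cayley_series_square prod_power_distrib)
    then have "F = cayley_series n c \<or> F = - cayley_series n c"
      by (simp add: power2_eq_iff)
    moreover have "fps_nth F 0 = 1"
      by (simp add: F_def fps_nth_prod_0 G_nth)
    ultimately show ?thesis
      by (auto simp: cayley_series_nth_0)
  qed
  ultimately show ?thesis by simp
qed

end

theory Submission
  imports Defs
begin

text \<open>
  Let \<open>Q = \<Prod>(1 - \<gamma>\<^sub>i t)\<close>, so that the series of the Cayley condition is \<open>sqrt Q\<close>. If its coefficients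
  of degree \<open>n + 1, \<dots>, 2 n - 1\<close> vanish and \<open>p\<close> is its truncation to degree \<open>n\<close>, then
  \<open>p\<^sup>2 - Q = b\<^sup>2 t\<^bsup>2n\<^esup>\<close> for some \<open>b\<close>, and \<open>Q = (p - b t\<^sup>n) (p + b t\<^sup>n)\<close> splits the indices into two sets
  whose polynomials differ only in degree \<open>n\<close>. In the variable \<open>x = 1 / t\<close> these are two monic
  polynomials of degree \<open>n\<close> which differ by a constant, one of them with the root \<open>0\<close>. All their
  roots are real and simple, so counting critical points determines the order in which the
  two families of roots appear on the line, and the two sets of indices are \<open>J\<close> and \<open>K\<close>. Conversely
  \<open>U V = ((U + V) / 2)\<^sup>2 - ((U - V) / 2)\<^sup>2\<close> recovers the Cayley condition. Conditions (i) to (iv) are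
  different ways to say that the polynomials of \<open>J\<close> and \<open>K\<close> agree below degree \<open>n\<close>.
\<close>

section \<open>The diagonal Cayley condition\<close>

text \<open>For \<open>m = n\<close> the Cayley matrix is a single column. One vector is linearly
  independent exactly if it is nonzero, and rank 1 is full column rank, so rank below 1 means that
  the column vanishes.\<close>

lemma (in vec_space) rank_single_column:
  assumes "A \<in> carrier_mat n 1"
  shows "rank A < 1 \<longleftrightarrow> col A 0 = 0\<^sub>v n"
proof -
  have cols: "cols A = [col A 0]"
    using assms by (auto simp: cols_def)
  then have "distinct (cols A)"
    by simp
  have carrier: "col A 0 \<in> carrier_vec n"
    using assms by auto
  have "rank A = 1 \<longleftrightarrow> lin_indpt (set (cols A))"
    using lin_indpt_full_rank full_rank_lin_indpt assms \<open>distinct (cols A)\<close> by blast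
  also have "\<dots> \<longleftrightarrow> col A 0 \<noteq> 0\<^sub>v n"
  proof
    assume "lin_indpt (set (cols A))"
    moreover have "(UNIV :: 'a set) \<noteq> {0}"
      by (metis UNIV_I singletonD zero_neq_one)
    ultimately have "0\<^sub>v n \<notin> set (cols A)"
      using zero_nin_lin_indpt[of "set (cols A)"] \<open>lin_indpt (set (cols A))\<close> carrier cols by simp
    then show "col A 0 \<noteq> 0\<^sub>v n"
      by (simp add: cols)
  next
    assume nonzero: "col A 0 \<noteq> 0\<^sub>v n"
    show "lin_indpt (set (cols A))"
    proof (rule finite_lin_indpt2)
      fix a
      assume "lincomb a (set (cols A)) = 0\<^sub>v n"
      then have "a (col A 0) \<cdot>\<^sub>v col A 0 = 0\<^sub>v n"
        using carrier by (auto simp: cols lincomb_def)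
      moreover obtain i where "i < n" "vec_index (col A 0) i \<noteq> 0"
        using nonzero carrier by (metis carrier_vecD eq_vecI index_zero_vec)
      ultimately have "a (col A 0) * vec_index (col A 0) i = 0"
        using carrier by (metis carrier_vecD index_smult_vec(1) index_zero_vec(1))
      then show "\<forall>v\<in>set (cols A). a v = 0"
        using \<open>vec_index (col A 0) i \<noteq> 0\<close> by (simp add: cols)
    qed (use carrier cols in auto)
  qed
  finally show ?thesis
    using rank_le_nc[OF assms] by auto
qed

lemma cayley_condition_diagonal:
  "cayley_condition n n c \<longleftrightarrow> (\<forall>l. n < l \<and> l < 2 * n \<longrightarrow> fps_nth (cayley_series n c) l = 0)"
proof -
  have "cayley_matrix n n c \<in> carrier_mat (n - 1) 1"
    by (simp add: cayley_matrix_def)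
  then have "cayley_condition n n c \<longleftrightarrow> col (cayley_matrix n n c) 0 = 0\<^sub>v (n - 1)"
    unfolding cayley_condition_def
    by (simp only: vec_space.rank_single_column diff_self_eq_0 add_0)
  also have "\<dots> \<longleftrightarrow> (\<forall>i < n - 1. fps_nth (cayley_series n c) (n + 1 + i) = 0)"
    by (auto simp: cayley_matrix_def Matrix.vec_eq_iff)
  also have "\<dots> \<longleftrightarrow> (\<forall>l. n < l \<and> l < 2 * n \<longrightarrow> fps_nth (cayley_series n c) l = 0)"
  proof safe
    fix l
    assume "\<forall>i < n - 1. fps_nth (cayley_series n c) (n + 1 + i) = 0" "n < l" "l < 2 * n"
    then show "fps_nth (cayley_series n c) l = 0"
      by (auto dest!: spec[of _ "l - n - 1"])
  qed auto
  finally show ?thesis .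
qed

section \<open>Power series modulo a power of the variable\<close>

text \<open>Expresses the vanishing of low coefficients as divisibility, so that products and units
  can be treated by ring theory. The zero series is treated apart because its subdegree is 0 by
  convention.\<close>

lemma fps_X_power_dvd_iff:
  fixes F :: "'a::field fps"
  shows "fps_X ^ m dvd F \<longleftrightarrow> (\<forall>i<m. fps_nth F i = 0)"
proof (cases "F = 0")
  case False
  then show ?thesis
    by (auto simp: fps_dvd_iff fps_X_power_subdegree intro!: subdegree_geI
        dest: order.strict_trans2)
qed auto

text \<open>Over a field, a nonzero constant coefficient makes \<open>U\<close> a unit, and units do
  not affect divisibility by \<open>fps_X ^ m\<close>.\<close>

lemma fps_mult_unit_nth_vanish:
  fixes F U :: "'a::field fps"
  assumes "fps_nth U 0 \<noteq> 0"
  shows "(\<forall>i<m. fps_nth (F * U) i = 0) \<longleftrightarrow> (\<forall>i<m. fps_nth F i = 0)"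
  using assms by (simp flip: fps_X_power_dvd_iff add: dvd_mult_unit_iff)

section \<open>Reciprocal polynomials\<close>

text \<open>This is the reversal of the monic polynomial with roots \<open>\<gamma> i\<close>. Taken
  over all indices it is the radicand in the Cayley condition, as
  \<open>c i = 1 / \<gamma> i\<close>.\<close>

definition recip_poly :: "(nat \<Rightarrow> real) \<Rightarrow> nat set \<Rightarrow> real poly" where
  "recip_poly \<gamma> A = (\<Prod>i\<in>A. [:1, - \<gamma> i:])"

lemma poly_recip_poly: "poly (recip_poly \<gamma> A) t = (\<Prod>i\<in>A. 1 - \<gamma> i * t)"
  by (simp add: recip_poly_def poly_prod mult.commute)

lemma coeff_recip_poly_0: "poly.coeff (recip_poly \<gamma> A) 0 = 1"
  by (simp add: poly_recip_poly flip: poly_0_coeff_0)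

lemma degree_recip_poly_le: "finite A \<Longrightarrow> Polynomial.degree (recip_poly \<gamma> A) \<le> card A"
  unfolding recip_poly_def using degree_prod_sum_le[of A "\<lambda>i. [:1, - \<gamma> i:]"]
    sum_bounded_above[of A "\<lambda>i. Polynomial.degree [:1, - \<gamma> i:]" 1]
  by (auto simp: o_def intro: order_trans)

lemma degree_recip_poly:
  "(\<And>i. i \<in> A \<Longrightarrow> \<gamma> i \<noteq> 0) \<Longrightarrow> Polynomial.degree (recip_poly \<gamma> A) = card A"
  unfolding recip_poly_def by (subst degree_prod_eq_sum_degree) auto

lemma recip_poly_Un:
  "finite A \<Longrightarrow> finite B \<Longrightarrow> A \<inter> B = {} \<Longrightarrow> recip_poly \<gamma> (A \<union> B) = recip_poly \<gamma> A * recip_poly \<gamma> B"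
  unfolding recip_poly_def by (rule prod.union_disjoint)

lemma poly_recip_poly_inverse:
  "x \<noteq> 0 \<Longrightarrow> poly (recip_poly \<gamma> A) (1 / x) * x ^ card A = (\<Prod>i\<in>A. x - \<gamma> i)"
  unfolding poly_recip_poly
  by (simp add: divide_simps prod_dividef)

text \<open>The distinct points \<open>1 / \<gamma> i\<close> together with 0, where the
  normalization fixes the value, are \<open>card A + 1\<close> points, enough to determine a
  polynomial of degree at most \<open>card A\<close>.\<close>

lemma recip_poly_eqI:
  assumes "finite A" "inj_on \<gamma> A" "\<And>i. i \<in> A \<Longrightarrow> \<gamma> i \<noteq> 0"
    and "Polynomial.degree U \<le> card A" "poly.coeff U 0 = 1"
    and "\<And>i. i \<in> A \<Longrightarrow> poly U (1 / \<gamma> i) = 0"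
  shows "U = recip_poly \<gamma> A"
proof -
  let ?R = "insert 0 ((\<lambda>i. 1 / \<gamma> i) ` A)"
  have "card ((\<lambda>i. 1 / \<gamma> i) ` A) = card A"
    using assms(2) by (intro card_image) (auto simp: inj_on_def)
  moreover have "0 \<notin> (\<lambda>i. 1 / \<gamma> i) ` A"
    using assms(3) by auto
  ultimately have "card ?R = Suc (card A)"
    using assms(1) by simp
  then show ?thesis
  proof (intro poly_eqI_degree[of ?R])
    fix x
    assume "x \<in> ?R"
    then show "poly U x = poly (recip_poly \<gamma> A) x"
      using assms by (auto simp: poly_0_coeff_0 coeff_recip_poly_0 poly_recip_poly)
  qed (use assms degree_recip_poly_le[of A \<gamma>] in auto)
qed

text \<open>The substitution \<open>x = 1 / t\<close> says nothing at 0; multiplying by the variable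
  fills this gap.\<close>

lemma poly_eq_0_off_0:
  fixes p :: "real poly"
  assumes "\<And>x. x \<noteq> 0 \<Longrightarrow> poly p x = 0"
  shows "p = 0"
proof -
  have "poly ([:0, 1:] * p) x = 0" for x
    using assms by (cases "x = 0") auto
  then have "[:0, 1:] * p = 0"
    using poly_all_0_iff_0 by blast
  then show ?thesis
    by simp
qed

text \<open>The substitution \<open>x = 1 / t\<close>.\<close>

lemma recip_poly_diff_eq_monom_iff:
  assumes "card A = Suc (card B)"
  shows "recip_poly \<gamma> A - recip_poly \<gamma> B = Polynomial.monom a (card A) \<longleftrightarrow>
         (\<forall>x. (\<Prod>i\<in>A. x - \<gamma> i) - a = x * (\<Prod>i\<in>B. x - \<gamma> i))"
    (is "?D = _ \<longleftrightarrow> (\<forall>x. ?l x = ?r x)")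
proof -
  \<comment> \<open>Multiplying by \<open>x ^ card A\<close> clears the denominators; since
    \<open>B\<close> has one element less, a factor \<open>x\<close> is left over on its
    side.\<close>
  have off_0: "poly (?D - Polynomial.monom a (card A)) (1 / x) * x ^ card A = ?l x - ?r x"
    if "x \<noteq> 0" for x
    using that poly_recip_poly_inverse[of x \<gamma> A] poly_recip_poly_inverse[of x \<gamma> B]
    by (simp add: poly_monom algebra_simps power_one_over assms)
  show ?thesis
  proof
    assume "?D = Polynomial.monom a (card A)"
    with off_0 have "x \<noteq> 0 \<Longrightarrow> ?l x = ?r x" for x
      by force
    then have "(\<Prod>i\<in>A. [:- \<gamma> i, 1:]) - [:a:] - [:0, 1:] * (\<Prod>i\<in>B. [:- \<gamma> i, 1:]) = 0"
      by (intro poly_eq_0_off_0) (simp add: poly_prod)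
    then have "poly ((\<Prod>i\<in>A. [:- \<gamma> i, 1:]) - [:a:] - [:0, 1:] * (\<Prod>i\<in>B. [:- \<gamma> i, 1:])) x = 0" for x
      by simp
    then show "\<forall>x. ?l x = ?r x"
      by (simp add: poly_prod)
  next
    assume eq: "\<forall>x. ?l x = ?r x"
    have "?D - Polynomial.monom a (card A) = 0"
    proof (rule poly_eq_0_off_0)
      fix t :: real
      assume "t \<noteq> 0"
      then show "poly (?D - Polynomial.monom a (card A)) t = 0"
        using off_0[of "1 / t"] eq by simp
    qed
    then show "?D = Polynomial.monom a (card A)"
      by simp
  qed
qed

text \<open>Expanding the product, each subset \<open>S\<close> of factors from which the linear
  term is chosen contributes one monomial of degree \<open>card S\<close>.\<close>

lemma coeff_recip_poly:
  assumes "finite A"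
  shows "poly.coeff (recip_poly \<gamma> A) l = (-1) ^ l * elem_sym l \<gamma> A"
proof -
  have "recip_poly \<gamma> A = (\<Prod>i\<in>A. Polynomial.monom (- \<gamma> i) 1 + 1)"
    unfolding recip_poly_def by (intro prod.cong) (auto simp: monom_altdef one_pCons)
  also have "\<dots> = (\<Sum>S\<in>Pow A. \<Prod>i\<in>S. Polynomial.monom (- \<gamma> i) 1)"
    by (simp add: prod_add[OF assms])
  also have "\<dots> = (\<Sum>S\<in>Pow A. Polynomial.monom ((-1) ^ card S * (\<Prod>i\<in>S. \<gamma> i)) (card S))"
  proof (intro sum.cong refl)
    fix S
    assume "S \<in> Pow A"
    then have "finite S"
      using assms finite_subset by blast
    then show "(\<Prod>i\<in>S. Polynomial.monom (- \<gamma> i) 1)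
        = Polynomial.monom ((-1) ^ card S * (\<Prod>i\<in>S. \<gamma> i)) (card S)"
      by (induction S) (auto simp: mult_monom one_pCons monom_0)
  qed
  also have "poly.coeff \<dots> l = (\<Sum>S\<in>Pow A. if card S = l then (-1) ^ l * (\<Prod>i\<in>S. \<gamma> i) else 0)"
    unfolding coeff_sum by (intro sum.cong) auto
  also have "\<dots> = (\<Sum>S | S \<subseteq> A \<and> card S = l. (-1) ^ l * (\<Prod>i\<in>S. \<gamma> i))"
    using assms by (subst sum.inter_filter[symmetric]) (auto simp: Pow_def)
  finally show ?thesis
    by (simp add: elem_sym_def sum_distrib_left)
qed

section \<open>Power sums\<close>

text \<open>The logarithmic derivative is minus the sum of the geometric series of \<gamma>/(1 -
  \<gamma> t), so its coefficient at \<open>l\<close> involves the power sum of exponent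
  \<open>Suc l\<close>. The equation is kept free of denominators.\<close>

lemma fps_deriv_recip_poly:
  assumes "finite A"
  shows "fps_deriv (fps_of_poly (recip_poly \<gamma> A)) =
         - fps_of_poly (recip_poly \<gamma> A) * Abs_fps (\<lambda>l. \<Sum>i\<in>A. \<gamma> i ^ Suc l)"
  using assms
proof (induction A)
  case empty
  have "Abs_fps (\<lambda>l. 0 :: real) = 0"
    by (simp add: fps_eq_iff)
  then show ?case
    by (simp add: recip_poly_def)
next
  case (insert k A)
  let ?a = "fps_of_poly (recip_poly \<gamma> A)" and ?u = "1 - fps_const (\<gamma> k) * fps_X"
    and ?g = "Abs_fps (\<lambda>l. \<gamma> k ^ Suc l)" and ?L = "Abs_fps (\<lambda>l. \<Sum>i\<in>A. \<gamma> i ^ Suc l)"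
  have split: "fps_of_poly (recip_poly \<gamma> (insert k A)) = ?u * ?a"
    using insert by (simp add: recip_poly_def fps_of_poly_mult fps_of_poly_linear'
        flip: fps_const_neg)
  have sum: "Abs_fps (\<lambda>l. \<Sum>i\<in>insert k A. \<gamma> i ^ Suc l) = ?g + ?L"
    using insert by (simp add: fps_eq_iff)
  have geometric: "?u * ?g = fps_const (\<gamma> k)"
  proof (rule fps_ext)
    fix l
    show "fps_nth (?u * ?g) l = fps_nth (fps_const (\<gamma> k)) l"
      by (cases l) (simp_all add: left_diff_distrib mult.assoc)
  qed
  have "fps_deriv (?u * ?a) = - fps_const (\<gamma> k) * ?a + ?u * (- ?a * ?L)"
    by (simp add: insert.IH)
  also have "\<dots> = - (?u * ?a) * (?g + ?L)"
  proof -
    have "- c * a + u * (- a * L) = - (u * a) * (g + L)" if "u * g = c" for a c g u L :: "real fps"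
      unfolding that[symmetric] by (simp add: algebra_simps)
    from this[OF geometric] show ?thesis .
  qed
  finally show ?case
    unfolding split sum .
qed

text \<open>
  Newton's identities in logarithmic form: the power sums are the coefficients of the
  logarithmic derivative, and the quotient of the two polynomials is compared with \<open>1\<close>.
\<close>

lemma recip_poly_coeffs_eq_iff_power_sums_eq:
  assumes "finite A" "finite B" "n \<ge> 1"
  shows "(\<forall>l<n. poly.coeff (recip_poly \<gamma> A) l = poly.coeff (recip_poly \<gamma> B) l) \<longleftrightarrow>
         (\<forall>l\<in>{1..n-1}. (\<Sum>i\<in>A. \<gamma> i ^ l) = (\<Sum>i\<in>B. \<gamma> i ^ l))"
proof -
  define a where "a = fps_of_poly (recip_poly \<gamma> A)"
  define b where "b = fps_of_poly (recip_poly \<gamma> B)"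
  define LA where "LA = Abs_fps (\<lambda>l. \<Sum>i\<in>A. \<gamma> i ^ Suc l)"
  define LB where "LB = Abs_fps (\<lambda>l. \<Sum>i\<in>B. \<gamma> i ^ Suc l)"
  define R where "R = a * inverse b"
  have a0: "fps_nth a 0 = 1" and b0: "fps_nth b 0 = 1"
    by (simp_all add: a_def b_def coeff_recip_poly_0)
  have R0: "fps_nth R 0 = 1"
    by (simp add: R_def a0 b0)
  have Rb: "R * b = a"
    by (simp add: R_def mult.assoc inverse_mult_eq_1 b0)
  have "fps_deriv a = - a * LA" "fps_deriv b = - b * LB"
    unfolding a_def b_def LA_def LB_def using assms by (simp_all add: fps_deriv_recip_poly)
  then have "- a * LA = fps_deriv R * b - R * b * LB"
    using arg_cong[OF Rb, of fps_deriv] by (simp add: mult.assoc)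
  \<comment> \<open>Up to the units \<open>a\<close> and \<open>b\<close>, the derivative of the
    quotient is the difference of the two power sum series.\<close>
  then have deriv: "fps_deriv R * b = (LB - LA) * a"
    by (simp add: Rb algebra_simps)
  have "(\<forall>l<n. poly.coeff (recip_poly \<gamma> A) l = poly.coeff (recip_poly \<gamma> B) l) \<longleftrightarrow>
        (\<forall>l<n. fps_nth ((R - 1) * b) l = 0)"
    using Rb by (simp add: left_diff_distrib a_def b_def)
  also have "\<dots> \<longleftrightarrow> (\<forall>l<n. fps_nth (R - 1) l = 0)"
    using b0 by (intro fps_mult_unit_nth_vanish) simp
  \<comment> \<open>Differentiation lowers the number of conditions by one; the lost one, at degree
    0, holds because \<open>R\<close> has constant coefficient 1.\<close>
  also have "\<dots> \<longleftrightarrow> (\<forall>l<n-1. fps_nth (fps_deriv R) l = 0)"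
  proof -
    have "(\<forall>l<Suc m. fps_nth (R - 1) l = 0) \<longleftrightarrow> (\<forall>l<m. fps_nth (fps_deriv R) l = 0)" for m
      unfolding All_less_Suc2 by (simp add: R0)
    from this[of "n - 1"] show ?thesis
      using assms(3) by simp
  qed
  also have "\<dots> \<longleftrightarrow> (\<forall>l<n-1. fps_nth (fps_deriv R * b) l = 0)"
    using b0 by (intro fps_mult_unit_nth_vanish[symmetric]) simp
  also have "\<dots> \<longleftrightarrow> (\<forall>l<n-1. fps_nth (LB - LA) l = 0)"
    unfolding deriv using a0 by (intro fps_mult_unit_nth_vanish) simp
  also have "\<dots> \<longleftrightarrow> (\<forall>l\<in>{1..n-1}. (\<Sum>i\<in>A. \<gamma> i ^ l) = (\<Sum>i\<in>B. \<gamma> i ^ l))"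
  proof safe
    fix l
    assume "\<forall>l<n-1. fps_nth (LB - LA) l = 0" "l \<in> {1..n-1}"
    then show "(\<Sum>i\<in>A. \<gamma> i ^ l) = (\<Sum>i\<in>B. \<gamma> i ^ l)"
      by (cases l) (auto simp: LA_def LB_def)
  next
    fix l
    assume "\<forall>l\<in>{1..n-1}. (\<Sum>i\<in>A. \<gamma> i ^ l) = (\<Sum>i\<in>B. \<gamma> i ^ l)" "l < n - 1"
    then show "fps_nth (LB - LA) l = 0"
      by (auto simp: LA_def LB_def dest!: bspec[of _ _ "Suc l"])
  qed
  finally show ?thesis .
qed

section \<open>Splitting the reciprocal polynomial\<close>

lemma cayley_series_square_eq_recip_poly:
  assumes "\<And>i. i \<in> {1..2*n-1} \<Longrightarrow> c i = 1 / \<gamma> i"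
  shows "cayley_series n c ^ 2 = fps_of_poly (recip_poly \<gamma> {1..2*n-1})"
  unfolding cayley_series_square recip_poly_def fps_of_poly_prod
  using assms by (intro prod.cong) (auto simp: fps_of_poly_linear' simp flip: fps_const_neg)

text \<open>
  The series agrees with the half sum of the two factors up to degree \<open>2 n - 1\<close>, because
  \<open>U V = ((U + V) / 2)\<^sup>2 - (C / 2)\<^sup>2 t\<^bsup>2 n\<^esup>\<close>.
\<close>

lemma square_root_vanishes_if_split:
  fixes F :: "real fps"
  assumes square: "F ^ 2 = fps_of_poly (U * V)" and "fps_nth F 0 = 1"
    and diff: "U - V = Polynomial.monom C n"
    and degrees: "Polynomial.degree U \<le> n" "Polynomial.degree V \<le> n"
    and "poly.coeff U 0 = 1" "poly.coeff V 0 = 1"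
    and "n < l" "l < 2 * n"
  shows "fps_nth F l = 0"
proof -
  define M where "M = Polynomial.smult (1/2) (U + V)"
  have M: "U + V = M + M"
    by (simp add: M_def flip: smult_add_left)
  have U: "U = M + Polynomial.monom (C / 2) n"
  proof (rule poly_eqI)
    fix i
    have "poly.coeff U i - poly.coeff V i = poly.coeff (Polynomial.monom C n) i"
      by (simp flip: diff)
    then show "poly.coeff U i = poly.coeff (M + Polynomial.monom (C / 2) n) i"
      by (simp add: M_def field_simps split: if_splits)
  qed
  have V: "V = M - Polynomial.monom (C / 2) n"
    using M U by (metis add_diff_cancel_left' add_diff_eq diff_diff_eq2)
  have "M * M - U * V = Polynomial.monom (C\<^sup>2 / 4) (2 * n)"
    unfolding U V by (simp add: algebra_simps mult_monom mult_2_right power2_eq_square)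
  then have "fps_of_poly (M * M) - F ^ 2 = fps_of_poly (Polynomial.monom (C\<^sup>2 / 4) (2 * n))"
    unfolding square by (metis fps_of_poly_diff)
  then have "(fps_of_poly M - F) * (fps_of_poly M + F) = fps_of_poly (Polynomial.monom (C\<^sup>2 / 4) (2 * n))"
    by (simp add: algebra_simps power2_eq_square fps_of_poly_mult)
  then have "\<forall>i < 2 * n. fps_nth ((fps_of_poly M - F) * (fps_of_poly M + F)) i = 0"
    by simp
  \<comment> \<open>This constant coefficient is 1 + 1, so the factor is a unit and all the
    vanishing falls on \<open>fps_of_poly M - F\<close>.\<close>
  moreover have "fps_nth (fps_of_poly M + F) 0 \<noteq> 0"
    using assms by (simp add: M_def)
  ultimately have "\<forall>i < 2 * n. fps_nth (fps_of_poly M - F) i = 0"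
    using fps_mult_unit_nth_vanish by blast
  moreover have "poly.coeff M l = 0"
    using degrees \<open>n < l\<close> by (simp add: M_def coeff_eq_0)
  ultimately show ?thesis
    using \<open>l < 2 * n\<close> by simp
qed

text \<open>The truncation \<open>p\<close> agrees with \<open>F\<close> below degree
  \<open>2 * n\<close>, so \<open>p * p - Q\<close> has no lower terms, while its degree is at most
  \<open>2 * n\<close>. It is thus the square of a monomial, and \<open>Q\<close> factors as a
  difference of squares. The total degree \<open>2 * n - 1\<close> leaves only the degrees
  \<open>n\<close> and \<open>n - 1\<close> for the factors.\<close>

lemma split_if_square_root_vanishes:
  fixes F :: "real fps"
  assumes square: "F ^ 2 = fps_of_poly Q" and F0: "fps_nth F 0 = 1"
    and degree: "Polynomial.degree Q = 2 * n - 1" and "n \<ge> 1"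
    and vanish: "\<And>l. n < l \<Longrightarrow> l < 2 * n \<Longrightarrow> fps_nth F l = 0"
  obtains U V C where "Q = U * V" "U - V = Polynomial.monom C n"
    "Polynomial.degree U = n" "Polynomial.degree V = n - 1"
    "poly.coeff U 0 = 1" "poly.coeff V 0 = 1"
proof -
  define p where "p = Poly (map (fps_nth F) [0..<Suc n])"
  have coeff_p: "poly.coeff p k = (if k \<le> n then fps_nth F k else 0)" for k
    by (auto simp: p_def nth_default_def simp del: upt_Suc)
  have degree_p: "Polynomial.degree p \<le> n"
    by (rule degree_le) (simp add: coeff_p)
  let ?b = "fps_nth F n"
  have "\<forall>i < 2 * n. fps_nth (fps_of_poly p - F) i = 0"
    using vanish by (auto simp: coeff_p)
  then have "fps_X ^ (2 * n) dvd (fps_of_poly p - F) * (fps_of_poly p + F)"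
    using fps_X_power_dvd_iff by (metis dvd_mult2)
  also have "(fps_of_poly p - F) * (fps_of_poly p + F) = fps_of_poly (p * p - Q)"
    using square by (simp add: algebra_simps power2_eq_square fps_of_poly_mult fps_of_poly_diff)
  finally have low: "poly.coeff (p * p - Q) i = 0" if "i < 2 * n" for i
    using that by (simp add: fps_X_power_dvd_iff)
  have "p * p - Q = Polynomial.monom (?b * ?b) (2 * n)"
  proof (rule poly_eqI)
    fix i
    have "poly.coeff Q i = 0" if "i \<ge> 2 * n"
      using that degree \<open>n \<ge> 1\<close> by (intro coeff_eq_0) linarith
    \<comment> \<open>In the convolution both indices must be at most \<open>n\<close>, so only the
      middle term survives.\<close>
    moreover have "poly.coeff (p * p) (n + n) = ?b * ?b"
    proof -
      have "poly.coeff (p * p) (n + n)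
          = (\<Sum>i\<le>n + n. if i = n then ?b * ?b else 0)"
        unfolding coeff_mult by (intro sum.cong) (auto simp: coeff_p)
      then show ?thesis
        by simp
    qed
    moreover have "poly.coeff (p * p) i = 0" if "i > 2 * n"
      using that degree_p degree_mult_le[of p p] by (intro coeff_eq_0) linarith
    ultimately show "poly.coeff (p * p - Q) i = poly.coeff (Polynomial.monom (?b * ?b) (2 * n)) i"
      using low[of i] by (cases i "2 * n" rule: linorder_cases) (auto simp: mult_2)
  qed
  then have factor: "Q = (p + Polynomial.monom ?b n) * (p - Polynomial.monom ?b n)"
    by (simp add: algebra_simps mult_monom mult_2_right)
  define U where "U = p + Polynomial.monom ?b n"
  define V where "V = p - Polynomial.monom ?b n"
  have Q: "Q = U * V" "Q = V * U"
    using factor by (simp_all add: U_def V_def)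
  \<comment> \<open>Both orders are recorded so that the factor of degree \<open>n\<close> can be
    named first in either case below.\<close>
  have diff: "U - V = Polynomial.monom (2 * ?b) n" "V - U = Polynomial.monom (- 2 * ?b) n"
    by (rule poly_eqI, simp only: U_def V_def coeff_add coeff_diff coeff_monom, simp)+
  have low_coeffs: "poly.coeff U 0 = 1" "poly.coeff V 0 = 1"
    using \<open>n \<ge> 1\<close> F0 by (simp_all add: U_def V_def coeff_p)
  have "Polynomial.degree U \<le> n" "Polynomial.degree V \<le> n"
    using degree_p degree_monom_le[of ?b n] unfolding U_def V_def
    by (auto intro: degree_add_le degree_diff_le)
  moreover have "Polynomial.degree U + Polynomial.degree V = 2 * n - 1"
    using degree low_coeffs unfolding Q(1) by (subst (asm) degree_mult_eq) auto
  ultimately consider "Polynomial.degree U = n" "Polynomial.degree V = n - 1"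
    | "Polynomial.degree V = n" "Polynomial.degree U = n - 1"
    by linarith
  then show thesis
    using that[OF Q(1) diff(1)] that[OF Q(2) diff(2)] low_coeffs by cases auto
qed

text \<open>Each of the \<open>2 * n - 1\<close> points \<open>1 / \<gamma> i\<close> is a root of
  \<open>U\<close> or of \<open>V\<close>, which have at most \<open>n\<close> and
  \<open>n - 1\<close> roots. Hence both bounds are attained and no point is shared.\<close>

lemma index_split:
  assumes "n \<ge> 1" "finite I" "card I = 2 * n - 1" "inj_on \<gamma> I" "\<And>i. i \<in> I \<Longrightarrow> \<gamma> i \<noteq> 0"
    and product: "recip_poly \<gamma> I = U * V" and diff: "U - V = Polynomial.monom C n"
    and degrees: "Polynomial.degree U = n" "Polynomial.degree V = n - 1"
    and low_coeffs: "poly.coeff U 0 = 1" "poly.coeff V 0 = 1"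
  obtains A B where "A \<union> B = I" "A \<inter> B = {}" "card A = n" "card B = n - 1"
    "U = recip_poly \<gamma> A" "V = recip_poly \<gamma> B"
proof -
  define R where "R W = {i\<in>I. poly W (1 / \<gamma> i) = 0}" for W
  have finite: "finite (R W)" for W
    using \<open>finite I\<close> by (simp add: R_def)
  have card_le: "card (R W) \<le> Polynomial.degree W" if "W \<noteq> 0" for W
  proof -
    have "card (R W) = card ((\<lambda>i. 1 / \<gamma> i) ` R W)"
      using assms(4) by (intro card_image[symmetric]) (auto simp: inj_on_def R_def)
    also have "\<dots> \<le> card {x. poly W x = 0}"
      using that poly_roots_finite by (intro card_mono) (auto simp: R_def)
    finally show ?thesis
      using card_poly_roots_bound[OF that] by linarith
  qed
  have un: "R U \<union> R V = I"
  proof -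
    have "poly U (1 / \<gamma> i) * poly V (1 / \<gamma> i) = 0" if "i \<in> I" for i
    proof -
      have "poly (recip_poly \<gamma> I) (1 / \<gamma> i) = 0"
        unfolding poly_recip_poly using assms(2,5) that by (auto intro!: prod_zero bexI[of _ i])
      then show ?thesis
        by (simp add: product)
    qed
    then show ?thesis
      by (auto simp: R_def)
  qed
  have "U \<noteq> 0" "V \<noteq> 0"
    using low_coeffs by auto
  then have "card (R U) \<le> n" "card (R V) \<le> n - 1"
    using card_le degrees by metis+
  moreover have "card I \<le> card (R U) + card (R V)"
    using card_Un_le[of "R U" "R V"] un by simp
  ultimately have cards: "card (R U) = n" "card (R V) = n - 1"
    using assms(1,3) by linarith+
  moreover have "card (R U) + card (R V) = card (R U \<union> R V) + card (R U \<inter> R V)"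
    by (rule card_Un_Int[OF finite finite])
  ultimately have "card (R U \<inter> R V) = 0"
    using assms(1,3) un by simp
  then have disjoint: "R U \<inter> R V = {}"
    using finite by auto
  have "inj_on \<gamma> (R U)" "inj_on \<gamma> (R V)"
    using assms(4) by (auto simp: R_def intro: inj_on_subset)
  then have "U = recip_poly \<gamma> (R U)" "V = recip_poly \<gamma> (R V)"
    using finite cards degrees low_coeffs assms(5) by (auto intro!: recip_poly_eqI simp: R_def)
  with that[OF un disjoint cards] show thesis .
qed

section \<open>The order of the roots\<close>

text \<open>Rolle between consecutive elements of \<open>S\<close>; the induction appends a new
  maximum. The location strictly between \<open>Min S\<close> and \<open>Max S\<close> is recorded
  so that critical points of separated level sets are distinct.\<close>

lemma card_critical_points_ge:
  fixes p :: "real poly"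
  assumes "finite S" "S \<noteq> {}" and "\<And>x. x \<in> S \<Longrightarrow> poly p x = v"
  shows "\<exists>T. finite T \<and> T \<subseteq> {Min S<..<Max S} \<inter> {x. poly (pderiv p) x = 0} \<and> card S \<le> Suc (card T)"
  using assms
proof (induction S rule: finite_linorder_max_induct)
  case (insert m S)
  show ?case
  proof (cases "S = {}")
    case True
    then show ?thesis
      by (intro exI[of _ "{}"]) simp
  next
    case False
    then obtain T where T: "finite T" "T \<subseteq> {Min S<..<Max S} \<inter> {x. poly (pderiv p) x = 0}"
      "card S \<le> Suc (card T)"
      using insert.IH insert.prems by auto
    have Max: "Max S \<in> S" "Max S < m" and Min: "Min S \<le> Max S"
      using insert.hyps False by auto
    obtain \<xi> where \<xi>: "Max S < \<xi>" "\<xi> < m"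
      "poly p m - poly p (Max S) = (m - Max S) * poly (pderiv p) \<xi>"
      using poly_MVT[OF Max(2)] by blast
    have "poly (pderiv p) \<xi> = 0"
      using \<xi>(3) insert.prems(2)[of m] insert.prems(2)[of "Max S"] Max by simp
    moreover have "Min (insert m S) = Min S" "Max (insert m S) = m"
      using Min_insert[OF insert.hyps(1) False, of m] Max_insert[OF insert.hyps(1) False, of m] Max Min
      by linarith+
    moreover have "Min S < \<xi>"
      using Min \<xi>(1) by linarith
    moreover have "\<xi> \<notin> T"
      using T \<xi> by auto
    moreover have "m \<notin> S"
      using insert.hyps by auto
    ultimately show ?thesis
      using T \<xi> Max(2) insert.hyps by (intro exI[of _ "insert \<xi> T"]) auto
  qed
qed simp

text \<open>
  Above a threshold lie at least \<open>card S - 1\<close> critical points, below it at least \<open>card T - 1\<close>,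
  and there are only \<open>degree p - 1\<close> in total.
\<close>

lemma card_level_sets_le_degree:
  fixes p :: "real poly"
  assumes "finite S" "finite T" and "\<And>x y. x \<in> S \<Longrightarrow> y \<in> T \<Longrightarrow> y < x"
    and "\<And>x. x \<in> S \<Longrightarrow> poly p x = v" and "\<And>x. x \<in> T \<Longrightarrow> poly p x = w"
    and "card S \<le> Polynomial.degree p" "card T \<le> Polynomial.degree p"
    and "Polynomial.degree p \<ge> 1"
  shows "card S + card T \<le> Polynomial.degree p + 1"
proof (cases "S = {} \<or> T = {}")
  case False
  obtain S' where S': "finite S'" "S' \<subseteq> {Min S<..<Max S} \<inter> {x. poly (pderiv p) x = 0}"
    "card S \<le> Suc (card S')"
    using card_critical_points_ge[of S p v] assms False by auto
  obtain T' where T': "finite T'" "T' \<subseteq> {Min T<..<Max T} \<inter> {x. poly (pderiv p) x = 0}"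
    "card T \<le> Suc (card T')"
    using card_critical_points_ge[of T p w] assms False by auto
  have "Max T < Min S"
    using assms False by simp
  then have "S' \<inter> T' = {}"
    using S' T' by fastforce
  then have "card S' + card T' = card (S' \<union> T')"
    using S' T' by (simp add: card_Un_disjoint)
  also have nonzero: "pderiv p \<noteq> 0"
    using assms by (auto simp: pderiv_eq_0_iff)
  then have "card (S' \<union> T') \<le> card {x. poly (pderiv p) x = 0}"
    using S' T' by (intro card_mono poly_roots_finite) auto
  also have "\<dots> \<le> Polynomial.degree p - 1"
    using card_poly_roots_bound[OF nonzero] by (simp add: degree_pderiv)
  finally show ?thesis
    using S' T' assms by linarith
qed (use assms in auto)

text \<open>The values decrease with the index, so the negative factors are those with index below
  \<open>j\<close>.\<close>

lemma sgn_prod_diff: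
  fixes y :: "nat \<Rightarrow> real"
  assumes "finite A" "j \<notin> A" "\<And>i. i \<in> A \<Longrightarrow> i < j \<Longrightarrow> y j < y i" "\<And>i. i \<in> A \<Longrightarrow> j < i \<Longrightarrow> y i < y j"
  shows "sgn (\<Prod>i\<in>A. y j - y i) = (-1) ^ card (A \<inter> {..j})"
  using assms
proof (induction A)
  case (insert k A)
  then have IH: "sgn (\<Prod>i\<in>A. y j - y i) = (-1) ^ card (A \<inter> {..j})"
    by auto
  consider "k < j" | "j < k"
    using insert.prems(1) by fastforce
  then show ?case
  proof cases
    case 1
    then have "insert k A \<inter> {..j} = insert k (A \<inter> {..j})" "y j < y k"
      using insert.prems by auto
    then show ?thesis
      using insert.hyps IH by (simp add: sgn_mult)
  next
    case 2
    then have "insert k A \<inter> {..j} = A \<inter> {..j}" "y k < y j"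
      using insert.prems by auto
    then show ?thesis
      using insert.hyps IH by (simp add: sgn_mult)
  qed
qed simp

text \<open>
  By the Rolle count the two level sets are balanced up to one element in every initial segment,
  so exactly balanced in those of even length; the sign of the polynomial of one
  level set at a point of the other then fixes the order inside each pair \<open>{2 k, 2 k + 1}\<close>.
\<close>

lemma level_set_alternation:
  fixes y :: "nat \<Rightarrow> real"
  assumes decreasing: "\<And>i j. 1 \<le> i \<Longrightarrow> i < j \<Longrightarrow> j \<le> 2 * n \<Longrightarrow> y j < y i"
    and un: "A \<union> B = {1..2*n}" and disjoint: "A \<inter> B = {}"
    and cards: "card A = n" "card B = n" and "2 * n \<in> B" "n \<ge> 1"
    and level: "\<And>x. (\<Prod>i\<in>A. x - y i) - a = (\<Prod>i\<in>B. x - y i)"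
  shows "A = {i \<in> {1..2*n}. odd (i div 2 + n)}"
proof -
  have finite: "finite A" "finite B"
    using un by (metis finite_Un finite_atLeastAtMost)+
  have inj: "inj_on y {1..2*n}"
    using decreasing by (intro linorder_inj_onI) force+
  define p where "p = (\<Prod>i\<in>A. [:- y i, 1:])"
  have poly_p: "poly p x = (\<Prod>i\<in>A. x - y i)" for x
    by (simp add: p_def poly_prod)
  have degree_p: "Polynomial.degree p = n"
    unfolding p_def by (subst degree_prod_eq_sum_degree) (auto simp: cards)
  have on_A: "poly p (y i) = 0" if "i \<in> A" for i
    using that finite unfolding poly_p by (auto intro!: prod_zero)
  have on_B: "poly p (y i) = a" if "i \<in> B" for i
  proof -
    have "(\<Prod>k\<in>B. y i - y k) = 0"
      using that finite by (auto intro!: prod_zero)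
    then show ?thesis
      unfolding poly_p using level[of "y i"] by simp
  qed
  have card_image: "card (y ` S) = card S" if "S \<subseteq> {1..2*n}" for S
    using that inj by (meson card_image inj_on_subset)
  \<comment> \<open>The values of \<open>S\<close> up to index \<open>m\<close> lie above those of
    \<open>T\<close> beyond \<open>m\<close>, so the Rolle count bounds their total number by
    \<open>n + 1\<close>; the complement in \<open>T\<close> turns this into the claim.\<close>
  have count: "card (S \<inter> {..m}) \<le> card (T \<inter> {..m}) + 1"
    if S: "S \<subseteq> {1..2*n}" "card S = n" "\<And>i. i \<in> S \<Longrightarrow> poly p (y i) = v"
      and T: "T \<subseteq> {1..2*n}" "card T = n" "\<And>i. i \<in> T \<Longrightarrow> poly p (y i) = w"
    for S T v w m
  proof -
    have fin: "finite S" "finite T"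
      using S T finite_subset by blast+
    have "card (T \<inter> {..m}) + card (T \<inter> {m<..}) = card (T \<inter> {..m} \<union> T \<inter> {m<..})"
      using fin by (subst card_Un_disjoint) auto
    also have "T \<inter> {..m} \<union> T \<inter> {m<..} = T"
      by auto
    finally have "card (T \<inter> {..m}) + card (T \<inter> {m<..}) = n"
      using T by simp
    moreover have "card (y ` (S \<inter> {..m})) + card (y ` (T \<inter> {m<..})) \<le> n + 1"
      unfolding degree_p[symmetric]
    proof (rule card_level_sets_le_degree)
      show "z < x" if "x \<in> y ` (S \<inter> {..m})" "z \<in> y ` (T \<inter> {m<..})" for x z
        using that S T by (auto intro!: decreasing)
      have "card (S \<inter> {..m}) \<le> n" "card (T \<inter> {m<..}) \<le> n"
        using S T fin card_mono by (metis Int_lower1)+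
      then show "card (y ` (S \<inter> {..m})) \<le> Polynomial.degree p"
        "card (y ` (T \<inter> {m<..})) \<le> Polynomial.degree p"
        using fin card_image_le degree_p by (metis finite_Int le_trans)+
    qed (use fin S T degree_p \<open>n \<ge> 1\<close> in auto)
    moreover have "card (y ` (S \<inter> {..m})) = card (S \<inter> {..m})"
      "card (y ` (T \<inter> {m<..})) = card (T \<inter> {m<..})"
      using S T by (auto intro!: card_image)
    ultimately show ?thesis
      by linarith
  qed
  have sub: "A \<subseteq> {1..2*n}" "B \<subseteq> {1..2*n}"
    using un by auto
  have balanced: "card (A \<inter> {..m}) \<le> card (B \<inter> {..m}) + 1" "card (B \<inter> {..m}) \<le> card (A \<inter> {..m}) + 1" for m
    using count[OF sub(1) cards(1) on_A sub(2) cards(2) on_B]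
      count[OF sub(2) cards(2) on_B sub(1) cards(1) on_A] by auto
  have total: "card (A \<inter> {..m}) + card (B \<inter> {..m}) = m" if "m \<le> 2 * n" for m
  proof -
    have "card (A \<inter> {..m}) + card (B \<inter> {..m}) = card (A \<inter> {..m} \<union> B \<inter> {..m})"
      using finite disjoint by (subst card_Un_disjoint) auto
    also have "A \<inter> {..m} \<union> B \<inter> {..m} = {1..m}"
      using un that by fastforce
    finally show ?thesis
      by simp
  qed
  have half: "card (S \<inter> {..j}) = j div 2"
    if S: "S = A \<and> j \<in> B \<or> S = B \<and> j \<in> A" for S j
  proof -
    have j: "1 \<le> j" "j \<le> 2 * n" "j \<notin> S"
      using S sub disjoint by auto
    have even: "card (S \<inter> {..2 * k}) = k" if "2 * k \<le> 2 * n" for k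
      using S balanced[of "2 * k"] total[OF that] by (elim disjE conjE; hypsubst; linarith)
    show ?thesis
    proof (cases "even j")
      case True
      then show ?thesis
        using even[of "j div 2"] j by simp
    next
      case False
      then have j_eq: "j = Suc (2 * (j div 2))"
        by simp
      have "S \<inter> {..j} = S \<inter> {..2 * (j div 2)}"
        using j by (subst (1) j_eq, unfold atMost_Suc) (simp add: j_eq[symmetric])
      then show ?thesis
        using even[of "j div 2"] j by simp
    qed
  qed
  have sgn_A: "sgn a = (-1) ^ (j div 2)" if "j \<in> B" for j
  proof -
    have "sgn (\<Prod>i\<in>A. y j - y i) = (-1) ^ card (A \<inter> {..j})"
      using that finite disjoint sub by (intro sgn_prod_diff decreasing) auto
    then show ?thesis
      using on_B[OF that] half that by (simp add: poly_p)
  qed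
  have sgn_B: "sgn (- a) = (-1) ^ (j div 2)" if "j \<in> A" for j
  proof -
    have "sgn (\<Prod>i\<in>B. y j - y i) = (-1) ^ card (B \<inter> {..j})"
      using that finite disjoint sub by (intro sgn_prod_diff decreasing) auto
    then show ?thesis
      using on_A[OF that] half that level[of "y j"] by (simp add: poly_p)
  qed
  \<comment> \<open>The last index is known to lie in \<open>B\<close>, which fixes the sign of the
    level \<open>a\<close> and so the parity for all other indices.\<close>
  have sgn_a: "sgn a = (-1) ^ n"
    using sgn_A[OF \<open>2 * n \<in> B\<close>] by simp
  have "even (j div 2 + n)" if "j \<in> B" for j
    using sgn_A[OF that] sgn_a by (cases "even n"; cases "even (j div 2)") auto
  moreover have "odd (j div 2 + n)" if "j \<in> A" for j
    using sgn_B[OF that] sgn_a by (cases "even n"; cases "even (j div 2)") (auto simp: sgn_minus)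
  ultimately show ?thesis
    using un by blast
qed

text \<open>The recursion takes every second pair \<open>{2 * k, 2 * k + 1}\<close>, downwards from
  \<open>k = n - 1\<close>, and \<open>i div 2\<close> numbers the pairs; the index 1 is what
  remains of the pair with \<open>k = 0\<close>. This is the form in which the alternation argument
  delivers the set.\<close>

lemma index_J_eq: "index_J n = {i \<in> {1..2*n-1}. odd (i div 2 + n)}"
proof (induction n rule: index_J.induct)
  case 3
  have "{1..3::nat} = {1, 2, 3}"
    by auto
  then have "{2, 3::nat} = {i \<in> {1..3}. odd (i div 2)}"
    by auto
  then show ?case
    by simp
next
  case (4 k)
  have step: "(1 \<le> i \<and> i \<le> 2 * k + 1 \<and> odd (i div 2 + Suc k)) \<or> i = 2 * k + 4 \<or> i = 2 * k + 5 \<longleftrightarrow>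
      1 \<le> i \<and> i \<le> 2 * k + 5 \<and> odd (i div 2 + Suc (Suc (Suc k)))" for i
  proof -
    define h where "h = i div 2"
    have "i = 2 * h \<or> i = Suc (2 * h)"
      unfolding h_def by presburger
    moreover have "h \<le> k \<or> h = Suc k \<or> h = k + 2 \<or> h > k + 2"
      by arith
    ultimately show ?thesis
      unfolding h_def[symmetric] by (elim disjE) auto
  qed
  have "i \<in> index_J (Suc (Suc (Suc k))) \<longleftrightarrow>
      (1 \<le> i \<and> i \<le> 2 * k + 1 \<and> odd (i div 2 + Suc k)) \<or> i = 2 * k + 4 \<or> i = 2 * k + 5" for i
  proof -
    have "i \<in> index_J (Suc (Suc (Suc k))) \<longleftrightarrow> i \<in> index_J (Suc k) \<or> i = 2 * k + 4 \<or> i = 2 * k + 5"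
      by auto
    then show ?thesis
      unfolding 4 by simp
  qed
  moreover have bound: "2 * Suc (Suc (Suc k)) - 1 = 2 * k + 5"
    by simp
  ultimately show ?case
    unfolding step bound by (simp add: set_eq_iff del: index_J.simps)
qed auto

lemma card_index_J: "card (index_J n) = n"
proof (induction n rule: index_J.induct)
  case (4 k)
  have "index_J (Suc k) \<inter> {2 * Suc (Suc (Suc k)) - 2, 2 * Suc (Suc (Suc k)) - 1} = {}"
    by (auto simp: index_J_eq)
  moreover have "finite (index_J (Suc k))"
    by (simp add: index_J_eq)
  ultimately show ?case
    using 4 by (simp add: card_Un_disjoint)
qed auto

lemma card_index_K: "card (index_K n) = n - 1"
  by (simp add: index_K_def card_index_J)

section \<open>The equivalences\<close>

lemma cayley_condition_iff_recip_poly_coeffs: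
  fixes \<gamma> c :: "nat \<Rightarrow> real"
  assumes "n \<ge> 1"
    and pos: "\<And>i. i \<in> {1..2*n-1} \<Longrightarrow> 0 < \<gamma> i"
    and decreasing: "\<And>i j. 1 \<le> i \<Longrightarrow> i < j \<Longrightarrow> j \<le> 2*n-1 \<Longrightarrow> \<gamma> j < \<gamma> i"
    and c: "\<And>i. i \<in> {1..2*n-1} \<Longrightarrow> c i = 1 / \<gamma> i"
  shows "cayley_condition n n c \<longleftrightarrow>
    (\<exists>a. recip_poly \<gamma> (index_J n) - recip_poly \<gamma> (index_K n) = Polynomial.monom a n)"
proof
  let ?I = "{1..2*n-1}"
  let ?f = "cayley_series n c"
  have square: "?f ^ 2 = fps_of_poly (recip_poly \<gamma> ?I)"
    using c by (rule cayley_series_square_eq_recip_poly)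
  have JK: "index_J n \<union> index_K n = ?I" "index_J n \<inter> index_K n = {}"
    using index_JK_decomposition[OF \<open>n \<ge> 1\<close>] .
  then have finite: "finite (index_J n)" "finite (index_K n)"
    by (metis finite_Un finite_atLeastAtMost)+
  {
    assume "\<exists>a. recip_poly \<gamma> (index_J n) - recip_poly \<gamma> (index_K n) = Polynomial.monom a n"
    then obtain a where
      a: "recip_poly \<gamma> (index_J n) - recip_poly \<gamma> (index_K n) = Polynomial.monom a n" ..
    have "recip_poly \<gamma> ?I = recip_poly \<gamma> (index_J n) * recip_poly \<gamma> (index_K n)"
      using recip_poly_Un[OF finite JK(2)] JK(1) by simp
    with square have "?f ^ 2 = fps_of_poly (recip_poly \<gamma> (index_J n) * recip_poly \<gamma> (index_K n))"
      by simp
    from square_root_vanishes_if_split[OF this cayley_series_nth_0 a]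
    show "cayley_condition n n c"
      unfolding cayley_condition_diagonal
      using degree_recip_poly_le[OF finite(1), of \<gamma>] degree_recip_poly_le[OF finite(2), of \<gamma>]
      by (simp add: card_index_J card_index_K coeff_recip_poly_0)
  next
    assume "cayley_condition n n c"
    then have vanish: "fps_nth ?f l = 0" if "n < l" "l < 2 * n" for l
      using that by (simp add: cayley_condition_diagonal)
    have inj: "inj_on \<gamma> ?I"
      using decreasing by (intro linorder_inj_onI) force+
    have nonzero: "\<gamma> i \<noteq> 0" if "i \<in> ?I" for i
      using pos[OF that] by simp
    have "Polynomial.degree (recip_poly \<gamma> ?I) = 2 * n - 1"
      using degree_recip_poly[of ?I \<gamma>] nonzero by simp
    then obtain U V C where UV: "recip_poly \<gamma> ?I = U * V" "U - V = Polynomial.monom C n"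
      "Polynomial.degree U = n" "Polynomial.degree V = n - 1" "poly.coeff U 0 = 1" "poly.coeff V 0 = 1"
      using split_if_square_root_vanishes[OF square cayley_series_nth_0 _ \<open>n \<ge> 1\<close> vanish] by metis
    then obtain A B where AB: "A \<union> B = ?I" "A \<inter> B = {}" "card A = n" "card B = n - 1"
      "U = recip_poly \<gamma> A" "V = recip_poly \<gamma> B"
      using index_split[OF \<open>n \<ge> 1\<close> _ _ inj nonzero UV] by auto
    \<comment> \<open>The extra index \<open>2 * n\<close> carries the root 0 of
      \<open>x * (\<Prod>i\<in>B. x - \<gamma> i)\<close>. Since all \<open>\<gamma> i\<close> are
      positive it comes last in the decreasing order, and both families now have \<open>n\<close>
      members.\<close>
    define y where "y i = (if i = 2 * n then 0 else \<gamma> i)" for i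
    have "2 * n \<notin> ?I"
      using \<open>n \<ge> 1\<close> by simp
    then have out: "2 * n \<notin> A" "2 * n \<notin> B"
      using AB(1) by blast+
    have "finite B"
      using AB(1) by (metis finite_Un finite_atLeastAtMost)
    have y_A: "(\<Prod>i\<in>A. x - y i) = (\<Prod>i\<in>A. x - \<gamma> i)" for x
      using out by (intro prod.cong) (auto simp: y_def)
    have y_B: "(\<Prod>i\<in>insert (2 * n) B. x - y i) = x * (\<Prod>i\<in>B. x - \<gamma> i)" for x
      using out \<open>finite B\<close> by (auto simp: y_def intro!: prod.cong)
    have "A = {i \<in> {1..2*n}. odd (i div 2 + n)}"
    proof (rule level_set_alternation)
      show "y j < y i" if "1 \<le> i" "i < j" "j \<le> 2 * n" for i j
        using that pos[of i] decreasing[of i j] by (auto simp: y_def)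
      have "Suc (2 * n - 1) = 2 * n"
        using \<open>n \<ge> 1\<close> by simp
      then have "{1..2*n} = insert (2 * n) ?I"
        using atLeastAtMostSuc_conv[of 1 "2 * n - 1"] by simp
      then show "A \<union> insert (2 * n) B = {1..2*n}"
        using AB(1) by blast
      show "(\<Prod>i\<in>A. x - y i) - C = (\<Prod>i\<in>insert (2 * n) B. x - y i)" for x
        using UV(2) AB \<open>n \<ge> 1\<close> recip_poly_diff_eq_monom_iff[of A B \<gamma> C]
        unfolding y_A y_B by simp
    qed (use AB out \<open>finite B\<close> \<open>n \<ge> 1\<close> in auto)
    then have "A = index_J n"
      using AB(1) by (auto simp: index_J_eq)
    moreover from this have "B = index_K n"
      using AB(1,2) JK by blast
    ultimately show "\<exists>a. recip_poly \<gamma> (index_J n) - recip_poly \<gamma> (index_K n) = Polynomial.monom a n"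
      using UV(2) AB by auto
  }
qed

theorem proposition12:
  fixes n :: nat and \<gamma> c :: "nat \<Rightarrow> real"
  assumes "n \<ge> 2"
    and pos: "\<And>i. i \<in> {1..2*n-1} \<Longrightarrow> 0 < \<gamma> i"
    and decreasing: "\<And>i j. 1 \<le> i \<Longrightarrow> i < j \<Longrightarrow> j \<le> 2*n-1 \<Longrightarrow> \<gamma> j < \<gamma> i"
    and c: "\<And>i. i \<in> {1..2*n-1} \<Longrightarrow> c i = 1 / \<gamma> i"
  defines "P \<equiv> \<lambda>x::real. \<Prod>j\<in>index_J n. (x - \<gamma> j)"
  shows "(cayley_condition n n c \<longleftrightarrow>
            (\<forall>x. P x - P 0 = x * (\<Prod>k\<in>index_K n. (x - \<gamma> k))))
       \<and> (cayley_condition n n c \<longleftrightarrow>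
            (\<forall>k\<in>index_K n. (\<Prod>j\<in>index_J n. (\<gamma> j - \<gamma> k)) = (\<Prod>j\<in>index_J n. \<gamma> j)))
       \<and> (cayley_condition n n c \<longleftrightarrow>
            (\<forall>l\<in>{1..n-1}. elem_sym l \<gamma> (index_J n) = elem_sym l \<gamma> (index_K n)))
       \<and> (cayley_condition n n c \<longleftrightarrow>
            (\<forall>l\<in>{1..n-1}. (\<Sum>j\<in>index_J n. \<gamma> j ^ l) = (\<Sum>k\<in>index_K n. \<gamma> k ^ l)))"
proof -
  have n: "n \<ge> 1"
    using \<open>n \<ge> 2\<close> by simp
  let ?J = "index_J n" and ?K = "index_K n"
  note JK = index_JK_decomposition[OF n]
  then have finite: "finite ?J" "finite ?K"
    by (metis finite_Un finite_atLeastAtMost)+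
  have card: "card ?J = Suc (card ?K)" "card ?J = n"
    using n by (simp_all add: card_index_J card_index_K)
  define D where "D = recip_poly \<gamma> ?J - recip_poly \<gamma> ?K"
  have degree_D: "Polynomial.degree D \<le> n"
    unfolding D_def using degree_recip_poly_le[OF finite(1), of \<gamma>] degree_recip_poly_le[OF finite(2), of \<gamma>] card
    by (intro degree_diff_le) auto
  have cayley: "cayley_condition n n c \<longleftrightarrow> (\<exists>a. D = Polynomial.monom a n)"
    unfolding D_def using n pos decreasing c by (rule cayley_condition_iff_recip_poly_coeffs)
  have monom_iff: "D = Polynomial.monom a n \<longleftrightarrow> (\<forall>x. P x - a = x * (\<Prod>k\<in>?K. x - \<gamma> k))" for a
    using recip_poly_diff_eq_monom_iff[OF card(1), of \<gamma> a] unfolding D_def P_def card(2) .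
  have i: "cayley_condition n n c \<longleftrightarrow> (\<forall>x. P x - P 0 = x * (\<Prod>k\<in>?K. x - \<gamma> k))"
  proof -
    \<comment> \<open>Evaluation at 0 determines the constant, which removes the existential
      quantifier.\<close>
    have "a = P 0" if "\<forall>x. P x - a = x * (\<Prod>k\<in>?K. x - \<gamma> k)" for a
      using that[rule_format, of 0] by simp
    then show ?thesis
      unfolding cayley monom_iff by blast
  qed
  have coeffs: "cayley_condition n n c \<longleftrightarrow>
      (\<forall>l<n. poly.coeff (recip_poly \<gamma> ?J) l = poly.coeff (recip_poly \<gamma> ?K) l)"
  proof -
    have "(\<exists>a. D = Polynomial.monom a n) \<longleftrightarrow> (\<forall>l<n. poly.coeff D l = 0)"
    proof
      assume low: "\<forall>l<n. poly.coeff D l = 0"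
      have "D = Polynomial.monom (poly.coeff D n) n"
      proof (rule poly_eqI)
        fix l
        show "poly.coeff D l = poly.coeff (Polynomial.monom (poly.coeff D n) n) l"
          using low degree_D by (cases l n rule: linorder_cases) (auto simp: coeff_eq_0)
      qed
      then show "\<exists>a. D = Polynomial.monom a n" ..
    qed auto
    then show ?thesis
      unfolding cayley by (simp add: D_def)
  qed
  have ii: "(\<forall>x. P x - P 0 = x * (\<Prod>k\<in>?K. x - \<gamma> k)) \<longleftrightarrow>
      (\<forall>k\<in>?K. (\<Prod>j\<in>?J. \<gamma> j - \<gamma> k) = (\<Prod>j\<in>?J. \<gamma> j))"
  proof -
    have neg: "P x = (-1) ^ n * (\<Prod>j\<in>?J. \<gamma> j - x)" for x
      using prod_uminus[of "\<lambda>j. \<gamma> j - x" ?J] by (simp add: P_def card(2))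
    have "(\<Prod>j\<in>?J. \<gamma> j - \<gamma> k) = (\<Prod>j\<in>?J. \<gamma> j) \<longleftrightarrow> P (\<gamma> k) = P 0" for k
      by (simp add: neg)
    moreover have "(\<forall>x. P x - P 0 = x * (\<Prod>k\<in>?K. x - \<gamma> k)) \<longleftrightarrow> (\<forall>k\<in>?K. P (\<gamma> k) = P 0)"
    proof safe
      fix k
      assume "\<forall>x. P x - P 0 = x * (\<Prod>k\<in>?K. x - \<gamma> k)" "k \<in> ?K"
      moreover from this have "(\<Prod>l\<in>?K. \<gamma> k - \<gamma> l) = 0"
        using finite by (auto intro!: prod_zero)
      ultimately show "P (\<gamma> k) = P 0"
        by (metis mult_zero_right right_minus_eq)
    next
      fix x
      assume agree: "\<forall>k\<in>?K. P (\<gamma> k) = P 0"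
      define p where "p = (\<Prod>j\<in>?J. [:- \<gamma> j, 1:])"
      \<comment> \<open>Both \<open>p\<close> and \<open>q\<close> are monic of degree
        \<open>n\<close>, so agreement at \<open>n\<close> points suffices: the \<open>n - 1\<close>
        values \<open>\<gamma> k\<close>, and 0, where \<open>q\<close> takes the value
        \<open>P 0\<close> by construction.\<close>
      define q where "q = [:P 0:] + [:0, 1:] * (\<Prod>k\<in>?K. [:- \<gamma> k, 1:])"
      have q_monic: "Polynomial.degree q = n \<and> poly.coeff q n = 1"
      proof -
        let ?r = "[:0, 1:] * (\<Prod>k\<in>?K. [:- \<gamma> k, 1:])"
        have "Polynomial.degree ?r = n"
          using card finite by (subst degree_mult_eq) (auto simp: degree_prod_eq_sum_degree)
        moreover have "lead_coeff ?r = 1"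
          by (simp only: lead_coeff_mult lead_coeff_prod) simp
        moreover have "Polynomial.degree q = Polynomial.degree ?r"
          unfolding q_def using n \<open>Polynomial.degree ?r = n\<close> by (intro degree_add_eq_right) auto
        moreover have "poly.coeff q n = poly.coeff ?r n"
          unfolding q_def using n by (cases n) auto
        ultimately show ?thesis
          by metis
      qed
      have p_monic: "Polynomial.degree p = n" "poly.coeff p n = 1"
      proof -
        show degree_p: "Polynomial.degree p = n"
          unfolding p_def using card by (subst degree_prod_eq_sum_degree) auto
        have "lead_coeff p = 1"
          unfolding p_def by (simp only: lead_coeff_prod) simp
        then show "poly.coeff p n = 1"
          by (simp add: degree_p)
      qed
      have "inj_on \<gamma> {1..2*n-1}"
        using decreasing by (intro linorder_inj_onI) force+
      then have inj: "inj_on \<gamma> ?K"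
        by (rule inj_on_subset) (use JK in blast)
      have "0 < \<gamma> k" if "k \<in> ?K" for k
        using JK that by (intro pos) blast
      then have "0 \<notin> \<gamma> ` ?K"
        by fastforce
      then have points: "card (insert 0 (\<gamma> ` ?K)) = n"
        using finite card card_image[OF inj] by simp
      have "p = q"
      proof (rule poly_eqI_degree_lead_coeff[where n = n and A = "insert 0 (\<gamma> ` ?K)"])
        fix z
        assume "z \<in> insert 0 (\<gamma> ` ?K)"
        then show "poly p z = poly q z"
          using agree finite by (auto simp: p_def q_def poly_prod P_def intro!: prod_zero)
      qed (use points p_monic q_monic in auto)
      then have "poly p x = poly q x"
        by simp
      then show "P x - P 0 = x * (\<Prod>k\<in>?K. x - \<gamma> k)"
        by (simp add: p_def q_def poly_prod P_def)
    qed
    ultimately show ?thesis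
      by simp
  qed
  have iii: "(\<forall>l<n. poly.coeff (recip_poly \<gamma> ?J) l = poly.coeff (recip_poly \<gamma> ?K) l) \<longleftrightarrow>
      (\<forall>l\<in>{1..n-1}. elem_sym l \<gamma> ?J = elem_sym l \<gamma> ?K)"
  proof -
    have "(\<forall>l<n. poly.coeff (recip_poly \<gamma> ?J) l = poly.coeff (recip_poly \<gamma> ?K) l) \<longleftrightarrow>
        (\<forall>l\<in>{1..n-1}. poly.coeff (recip_poly \<gamma> ?J) l = poly.coeff (recip_poly \<gamma> ?K) l)"
    proof safe
      fix l
      assume "\<forall>l\<in>{1..n-1}. poly.coeff (recip_poly \<gamma> ?J) l = poly.coeff (recip_poly \<gamma> ?K) l" "l < n"
      then show "poly.coeff (recip_poly \<gamma> ?J) l = poly.coeff (recip_poly \<gamma> ?K) l"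
        by (cases "l = 0") (auto simp: coeff_recip_poly_0)
    qed auto
    then show ?thesis
      by (simp add: coeff_recip_poly finite)
  qed
  show ?thesis
    using i ii coeffs iii recip_poly_coeffs_eq_iff_power_sums_eq[OF finite n, of \<gamma>] by simp
qed

end
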